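(* Let $\mathbb F$ be an algebraically closed field and let $q\in\mathbb F$ be nonzero and not a root of unity. Let $V$ denote an evaluation module for $\boxtimes_q$ that has diameter $d$, and for each $j\in\mathbb Z_4$ let $\eta_j$ be a nonzero vector in component $0$ of the flag $[j]$ on $V$. Given mutually distinct $i,j,k,\ell\in\mathbb Z_4$ there exists a unique basis $\{u_n\}_{n=0}^d$ for $V$ such that (i), (ii) hold below: (i) for $0\le n\le d$ the vector $u_n$ is contained in component $n$ of the decomposition $[k,\ell]$ of $V$; (ii) $\eta_j=\sum_{n=0}^du_n$.
   Context: Algebras are associative with 1. $[n]_q=(q^n-q^{-n})/(q-q^{-1})$ and $\mathbb Z_4=\mathbb Z/4\mathbb Z$. The $q$-tetrahedron algebra $\boxtimes_q$ is the $\mathbb F$-algebra with generators (called the standard generators) $\{x_{ij}\mid i,j\in\mathbb Z_4,\ j-i=1\text{ or }j-i=2\}$ and relations: (i) $x_{ij}x_{ji}=1$ if $j-i=2$; (ii) $\frac{qx_{ij}x_{jk}-q^{-1}x_{jk}x_{ij}}{q-q^{-1}}=1$ if $(j-i,k-j)$ is one of $(1,1),(1,2),(2,1)$; (iii) $x_{ij}^3x_{k\ell}-[3]_qx_{ij}^2x_{k\ell}x_{ij}+[3]_qx_{ij}x_{k\ell}x_{ij}^2-x_{k\ell}x_{ij}^3=0$ if $j-i=k-j=\ell-k=1$. Known fact: on a finite-dimensional irreducible $\boxtimes_q$-module $V$ there are $d\in\mathbb N$ (the diameter) and $\varepsilon\in\{1,-1\}$ (the type) such that each standard generator is diagonalizable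 with set of distinct eigenvalues $\{\varepsilon q^{d-2n}\mid 0\le n\le d\}$. Let $V$ have type 1. For distinct $i,j\in\mathbb Z_4$ the decomposition $[i,j]$ of $V$ is the sequence of subspaces $\{V_n\}_{n=0}^d$ (with $V=\bigoplus_n V_n$) such that: if $j-i\in\{1,2\}$, $V_n$ is the eigenspace of $x_{ij}$ with eigenvalue $q^{d-2n}$; if $j-i=3$, $[i,j]$ is the inversion (reversed sequence) of $[j,i]$. The shape $(\dim V_n)_{n=0}^d$ does not depend on $i,j$. For $i\in\mathbb Z_4$ the flag $[i]$ on $V$ has $n$th component $V_0+\cdots+V_n$, where $\{V_n\}$ is the decomposition $[i,j]$; this is known not to depend on $j\ne i$. The trivial $\boxtimes_q$-module is the one-dimensional module on which every standard generator acts as the identity. An evaluation module for $\boxtimes_q$ is a nontrivial finite-dimensional irreducible $\boxtimes_q$-module of type 1 and shape $(1,1,\dots,1)$ (so $d\ge1$, $\dim V=d+1$). *)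

theory Defs
  imports
    "HOL-Library.Numeral_Type"
    "HOL-Library.FuncSet"
    "HOL-Library.Poly_Mapping"
    "HOL-Computational_Algebra.Polynomial"
    "HOL-Algebra.QuotRing"
    "HOL-Algebra.Algebraic_Closure_Type"
begin

section \<open>Free associative algebras\<close>

text \<open>The free associative unital algebra over \<open>'f\<close> on the set \<open>'g\<close> is the monoid algebra of the
  free monoid of words in \<open>'g\<close>. The additive notation for concatenation is forced by
  \<^typ>\<open>'a \<Rightarrow>\<^sub>0 'b\<close>, whose product is the convolution product along the addition of the index type.\<close>

datatype 'a gen_word = Word "'a list"

instantiation gen_word :: (type) monoid_add
begin

definition zero_gen_word :: "'a gen_word" where "0 = Word []"

fun plus_gen_word :: "'a gen_word \<Rightarrow> 'a gen_word \<Rightarrow> 'a gen_word" where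
  "Word u + Word v = Word (u @ v)"

instance
proof
  fix a b c :: "'a gen_word"
  show "a + b + c = a + (b + c)" by (cases a; cases b; cases c) simp
  show "0 + a = a" by (cases a) (simp add: zero_gen_word_def)
  show "a + 0 = a" by (cases a) (simp add: zero_gen_word_def)
qed

end

type_synonym ('g, 'f) free_algebra = "'g gen_word \<Rightarrow>\<^sub>0 'f"

definition free_gen :: "'g \<Rightarrow> ('g, 'f::field) free_algebra" where
  "free_gen g = Poly_Mapping.single (Word [g]) 1"

definition free_scalar :: "'f::field \<Rightarrow> ('g, 'f) free_algebra" where
  "free_scalar c = Poly_Mapping.single 0 c"

section \<open>The \<open>q\<close>-tetrahedron algebra\<close>

text \<open>\<open>\<int>\<^sub>4\<close> is the type \<open>4\<close> of integers modulo 4.\<close>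

typedef std_gen = "{(i, j). j - i = (1 :: 4) \<or> j - i = 2}"
  by (intro exI[of _ "(0, 1)"]) simp

text \<open>\<open>fx i j\<close> is meaningful only if \<open>j - i \<in> {1, 2}\<close>.\<close>

definition fx :: "4 \<Rightarrow> 4 \<Rightarrow> (std_gen, 'f::field) free_algebra" where
  "fx i j = free_gen (Abs_std_gen (i, j))"

definition qint :: "'f::field \<Rightarrow> nat \<Rightarrow> 'f" where
  "qint q n = (q ^ n - inverse q ^ n) / (q - inverse q)"

text \<open>The elements \<open>lhs - rhs\<close> for the defining relations \<open>lhs = rhs\<close>.\<close>

definition qtet_relators :: "'f::field \<Rightarrow> (std_gen, 'f) free_algebra set" where
  "qtet_relators q =
     {fx i j * fx j i - 1 | i j. j - i = 2}
   \<union> {free_scalar (1 / (q - inverse q)) *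
        (free_scalar q * fx i j * fx j k - free_scalar (inverse q) * fx j k * fx i j) - 1
       | i j k. (j - i, k - j) \<in> {(1, 1), (1, 2), (2, 1)}}
   \<union> {fx i j ^ 3 * fx k l
        - free_scalar (qint q 3) * fx i j ^ 2 * fx k l * fx i j
        + free_scalar (qint q 3) * fx i j * fx k l * fx i j ^ 2
        - fx k l * fx i j ^ 3
       | i j k l. j - i = 1 \<and> k - j = 1 \<and> l - k = 1}"

definition qtet_ideal :: "'f::field \<Rightarrow> (std_gen, 'f) free_algebra set" where
  "qtet_ideal q = genideal ring_of_type_algebra (qtet_relators q)"

definition qtet :: "'f::field \<Rightarrow> (std_gen, 'f) free_algebra set ring" where
  "qtet q = ring_of_type_algebra Quot qtet_ideal q"

definition qtet_class :: "'f::field \<Rightarrow> (std_gen, 'f) free_algebra \<Rightarrow> (std_gen, 'f) free_algebra set" where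
  "qtet_class q p = qtet_ideal q +>\<^bsub>ring_of_type_algebra\<^esub> p"

text \<open>The \<open>'f\<close>-algebra structure of \<^term>\<open>qtet q\<close> is given by the ring homomorphism
  \<^term>\<open>qtet_scalar q\<close> from \<open>'f\<close> to its centre.\<close>

definition qtet_scalar :: "'f::field \<Rightarrow> 'f \<Rightarrow> (std_gen, 'f) free_algebra set" where
  "qtet_scalar q c = qtet_class q (free_scalar c)"

definition qtet_gen :: "'f::field \<Rightarrow> 4 \<Rightarrow> 4 \<Rightarrow> (std_gen, 'f) free_algebra set" where
  "qtet_gen q i j = qtet_class q (fx i j)"

section \<open>Modules\<close>

text \<open>The vector space is the whole type \<open>'v\<close>.\<close>

locale qtet_module = vector_space scale
  for scale :: "'f::field \<Rightarrow> 'v::ab_group_add \<Rightarrow> 'v" (infixr \<open>*s\<close> 75) +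
  fixes q :: 'f
    and act :: "(std_gen, 'f) free_algebra set \<Rightarrow> 'v \<Rightarrow> 'v"
  assumes act_linear: "a \<in> carrier (qtet q) \<Longrightarrow> Vector_Spaces.linear scale scale (act a)"
    and act_add: "a \<in> carrier (qtet q) \<Longrightarrow> b \<in> carrier (qtet q) \<Longrightarrow>
          act (a \<oplus>\<^bsub>qtet q\<^esub> b) v = act a v + act b v"
    and act_mult: "a \<in> carrier (qtet q) \<Longrightarrow> b \<in> carrier (qtet q) \<Longrightarrow>
          act (a \<otimes>\<^bsub>qtet q\<^esub> b) v = act a (act b v)"
    and act_one: "act \<one>\<^bsub>qtet q\<^esub> v = v"
    and act_scalar: "act (qtet_scalar q c) v = c *s v"
begin

definition finite_dimensional :: bool where
  "finite_dimensional \<longleftrightarrow> (\<exists>B. finite B \<and> span B = UNIV)"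

definition submodule :: "'v set \<Rightarrow> bool" where
  "submodule W \<longleftrightarrow> subspace W \<and> (\<forall>a\<in>carrier (qtet q). \<forall>w\<in>W. act a w \<in> W)"

definition irreducible_module :: bool where
  "irreducible_module \<longleftrightarrow>
     (UNIV :: 'v set) \<noteq> {0} \<and> (\<forall>W. submodule W \<longrightarrow> W = {0} \<or> W = UNIV)"

definition trivial_module :: bool where
  "trivial_module \<longleftrightarrow>
     dim UNIV = 1 \<and> (\<forall>i j v. j - i \<in> {1, 2} \<longrightarrow> act (qtet_gen q i j) v = v)"

definition eigenspace :: "('v \<Rightarrow> 'v) \<Rightarrow> 'f \<Rightarrow> 'v set" where
  "eigenspace T c = {v. T v = c *s v}"

definition eigenvalues :: "('v \<Rightarrow> 'v) \<Rightarrow> 'f set" where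
  "eigenvalues T = {c. \<exists>v. v \<noteq> 0 \<and> v \<in> eigenspace T c}"

definition diagonalizable :: "('v \<Rightarrow> 'v) \<Rightarrow> bool" where
  "diagonalizable T \<longleftrightarrow>
     (\<exists>B. independent B \<and> span B = UNIV \<and> (\<forall>b\<in>B. \<exists>c. b \<in> eigenspace T c))"

definition has_diameter_and_type :: "nat \<Rightarrow> 'f \<Rightarrow> bool" where
  "has_diameter_and_type d \<epsilon> \<longleftrightarrow> \<epsilon> \<in> {1, -1} \<and>
     (\<forall>i j. j - i \<in> {1, 2} \<longrightarrow>
        diagonalizable (act (qtet_gen q i j)) \<and>
        eigenvalues (act (qtet_gen q i j)) = {\<epsilon> * q powi (int d - 2 * int n) | n. n \<le> d})"

text \<open>\<open>decomposition d i j n\<close> is the component \<open>n\<close> of \<open>[i,j]\<close> on a module of type 1 and diameter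
  \<open>d\<close>; it is meaningful only if \<open>i \<noteq> j\<close> and \<open>n \<le> d\<close>. The second branch is the case \<open>j - i = 3\<close>.\<close>

definition decomposition :: "nat \<Rightarrow> 4 \<Rightarrow> 4 \<Rightarrow> nat \<Rightarrow> 'v set" where
  "decomposition d i j n =
     (if j - i \<in> {1, 2}
      then eigenspace (act (qtet_gen q i j)) (q powi (int d - 2 * int n))
      else eigenspace (act (qtet_gen q j i)) (q powi (int d - 2 * int (d - n))))"

text \<open>The flag \<open>[i]\<close> is induced by \<open>[i,j]\<close> for any \<open>j \<noteq> i\<close>, independently of \<open>j\<close>; here \<open>j = i + 1\<close>.\<close>

definition flag :: "nat \<Rightarrow> 4 \<Rightarrow> nat \<Rightarrow> 'v set" where
  "flag d i n = {\<Sum>m\<le>n. w m | w. \<forall>m\<le>n. w m \<in> decomposition d i (i + 1) m}"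

definition evaluation_module :: "nat \<Rightarrow> bool" where
  "evaluation_module d \<longleftrightarrow>
     finite_dimensional \<and> irreducible_module \<and> \<not> trivial_module \<and>
     has_diameter_and_type d 1 \<and>
     (\<forall>i j n. i \<noteq> j \<and> n \<le> d \<longrightarrow> dim (decomposition d i j n) = 1)"

definition basis_seq :: "nat \<Rightarrow> (nat \<Rightarrow> 'v) \<Rightarrow> bool" where
  "basis_seq d u \<longleftrightarrow>
     inj_on u {..d} \<and> independent (u ` {..d}) \<and> span (u ` {..d}) = UNIV"

end

end

theory Submission
  imports Defs
begin

text \<open>The components of \<open>[k,l]\<close> are the eigenspaces of a diagonalizable operator, so \<open>\<eta> j\<close> has exactly
  one expansion \<open>\<Sum>n. u n\<close> with \<open>u n\<close> in component \<open>n\<close>. Since all components are one-dimensional,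
  the \<open>u n\<close> form a basis as soon as none of them vanishes. The content of the theorem is therefore
  that every component of \<open>\<eta> j\<close> in \<open>[k,l]\<close> is nonzero.

  Reversing \<open>[k,l]\<close> if necessary, one may assume that \<open>j, k, l\<close> follow each other in the cyclic order of
  \<open>\<int>\<^sub>4\<close>, so that \<open>x = x\<^sub>j\<^sub>k\<close>, \<open>y = x\<^sub>k\<^sub>l\<close> and \<open>z = x\<^sub>l\<^sub>j\<close> are standard generators, with \<open>q\<close>-Weyl
  relations for the pairs \<open>(x, y)\<close> and \<open>(y, z)\<close>. The vector \<open>\<eta> j\<close> is an eigenvector of \<open>x\<close> with
  eigenvalue \<open>q\<^sup>d\<close> and of \<open>z\<close> with eigenvalue \<open>q\<^sup>-\<^sup>d\<close>; this also comes from \<open>q\<close>-Weyl relations, applied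
  at an extreme eigenvalue (\<open>q_weyl_common_eigenvector\<close>, \<open>flag_vector_eigenvector\<close>).

  On the \<open>y\<close>-eigenspace with eigenvalue \<open>\<theta>\<close>, the relation for \<open>(x, y)\<close> says that
  \<open>x - \<theta>\<inverse>\<close> maps into the eigenspace with eigenvalue \<open>q\<^sup>2\<theta>\<close> (\<open>q_weyl_raises\<close>), that is,
  from component \<open>n\<close> to component \<open>n - 1\<close>. Comparing components in \<open>x \<eta> = q\<^sup>d \<eta>\<close> expresses a nonzero
  multiple of component \<open>n\<close> through component \<open>n + 1\<close>, for \<open>n < d\<close>. Hence vanishing passes from
  \<open>n + 1\<close> to \<open>n\<close> (\<open>q_weyl_component_propagates\<close>). The relation for \<open>(y, z)\<close> is the
  same relation with \<open>q\<close> replaced by \<open>q\<inverse>\<close>, so vanishing passes from \<open>n\<close> to \<open>n + 1\<close> as well. One vanishing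
  component would make all of them vanish, contrary to \<open>\<eta> j \<noteq> 0\<close>
  (\<open>q_weyl_triple_components_nonzero\<close>).\<close>

section \<open>Powers of an element of infinite multiplicative order\<close>

lemma power_int_eq_iff_of_infinite_order:
  fixes c :: "'f::field"
  assumes c0: "c \<noteq> 0" and inf: "\<And>n::nat. n > 0 \<Longrightarrow> c ^ n \<noteq> 1"
  shows "c powi a = c powi b \<longleftrightarrow> a = b"
proof -
  have no: "c powi e \<noteq> 1" if "e > 0" for e :: int
    using inf[of "nat e"] that by (simp add: power_int_def)
  have "\<not> a < b" if "c powi a = c powi b" for a b
  proof
    assume "a < b"
    have "c powi (b - a) = 1"
      using that c0 by (simp add: power_int_diff)
    with no[of "b - a"] \<open>a < b\<close> show False by simp
  qed
  from this[of a b] this[of b a] show ?thesis by (metis linorder_less_linear)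
qed

lemma diff_inverse_neq_0_of_infinite_order:
  fixes c :: "'f::field"
  assumes "c \<noteq> 0" and "\<And>n::nat. n > 0 \<Longrightarrow> c ^ n \<noteq> 1"
  shows "c - inverse c \<noteq> 0"
  using assms(2)[of 2] assms(1) by (auto simp: field_simps power2_eq_square)

section \<open>Eigenvector expansions\<close>

context vector_space
begin

lemma sum_eigenvectors_eq_0:
  assumes lin: "Vector_Spaces.linear scale scale T"
    and fin: "finite A" and inj: "inj_on \<theta> A"
    and eig: "\<And>n. n \<in> A \<Longrightarrow> T (w n) = scale (\<theta> n) (w n)"
    and sum0: "(\<Sum>n\<in>A. w n) = 0" and m: "m \<in> A"
  shows "w m = 0"
  using fin inj eig sum0 m
proof (induction A arbitrary: w m rule: finite_induct)
  case empty
  then show ?case by simp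
next
  case (insert a A)
  interpret T: Vector_Spaces.linear scale scale T by (rule lin)
  \<comment> \<open>Applying \<open>T - \<theta> a\<close> removes the term at \<open>a\<close> and multiplies every other term by a nonzero
    scalar.\<close>
  have "(\<Sum>n\<in>A. scale (\<theta> n - \<theta> a) (w n)) = (\<Sum>n\<in>insert a A. scale (\<theta> n - \<theta> a) (w n))"
    using insert.hyps by simp
  also have "\<dots> = (\<Sum>n\<in>insert a A. T (w n)) - scale (\<theta> a) (\<Sum>n\<in>insert a A. w n)"
    unfolding scale_sum_right sum_subtractf[symmetric]
    by (rule sum.cong) (simp_all add: insert.prems(2) scale_left_diff_distrib)
  also have "\<dots> = 0"
    using insert.prems(3) by (simp add: T.sum[symmetric])
  finally have s: "(\<Sum>n\<in>A. scale (\<theta> n - \<theta> a) (w n)) = 0" .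
  have z: "w n = 0" if n: "n \<in> A" for n
  proof -
    have "scale (\<theta> n - \<theta> a) (w n) = 0"
      by (rule insert.IH[OF _ _ s n])
        (use insert.prems in \<open>auto simp: T.scale mult.commute\<close>)
    moreover have "\<theta> n \<noteq> \<theta> a"
      using insert.prems(1) insert.hyps n by (auto simp: inj_on_def)
    ultimately show ?thesis by simp
  qed
  moreover have "w a = 0"
    using insert.prems(3) insert.hyps z by simp
  ultimately show ?case using insert.prems(4) by auto
qed

lemma ex_eigenvector_expansion:
  assumes lin: "Vector_Spaces.linear scale scale T"
    and fin: "finite A"
    and B: "independent B" "span B = UNIV"
    and eig: "\<And>b. b \<in> B \<Longrightarrow> \<exists>n\<in>A. T b = scale (\<theta> n) b"
  shows "\<exists>w. (\<forall>n\<in>A. T (w n) = scale (\<theta> n) (w n)) \<and> v = (\<Sum>n\<in>A. w n)"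
proof -
  interpret T: Vector_Spaces.linear scale scale T by (rule lin)
  have "v \<in> span B" using B by simp
  then show ?thesis
  proof (induction rule: span_induct_alt)
    case base
    show ?case by (intro exI[of _ "\<lambda>_. 0"]) (simp add: T.zero)
  next
    case (step c b y)
    obtain w where w: "\<forall>n\<in>A. T (w n) = scale (\<theta> n) (w n)" "y = (\<Sum>n\<in>A. w n)"
      using step.IH by blast
    obtain m where m: "m \<in> A" "T b = scale (\<theta> m) b"
      using eig step.hyps by blast
    define w' where "w' n = (if n = m then scale c b else 0) + w n" for n
    have "(\<Sum>n\<in>A. w' n) = scale c b + y"
      using fin m w by (simp add: w'_def sum.distrib)
    moreover have "T (w' n) = scale (\<theta> n) (w' n)" if "n \<in> A" for n
      using that w m
      by (auto simp: w'_def T.add T.scale T.zero scale_right_distrib mult.commute)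
    ultimately show ?case by metis
  qed
qed

lemma subset_span_of_dim_1:
  assumes "dim S = 1" "v \<in> S" "v \<noteq> 0"
  shows "S \<subseteq> span {v}"
proof -
  obtain B where B: "B \<subseteq> S" "independent B" "S \<subseteq> span B" "card B = dim S"
    using basis_exists by blast
  then obtain b where b: "B = {b}" using assms(1) card_1_singletonE by metis
  then obtain c where c: "v = scale c b" using B assms(2) by (auto simp: span_singleton)
  then have "b = scale (inverse c) v" using assms(3) by auto
  then have "b \<in> span {v}" by (metis span_base span_scale singletonI)
  then show ?thesis using B b span_minimal[of "{b}" "span {v}"] by auto
qed

section \<open>The \<open>q\<close>-Weyl relation\<close>

end

definition q_weyl :: "('f::field \<Rightarrow> 'v::ab_group_add \<Rightarrow> 'v) \<Rightarrow> 'f \<Rightarrow> ('v \<Rightarrow> 'v) \<Rightarrow> ('v \<Rightarrow> 'v) \<Rightarrow> bool" where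
  "q_weyl scale c x y \<longleftrightarrow>
     (\<forall>v. scale c (x (y v)) - scale (inverse c) (y (x v)) = scale (c - inverse c) v)"

context vector_space
begin

text \<open>This symmetry turns a statement about lowering the index of a component into one about
  raising it.\<close>

lemma q_weyl_inverse: "q_weyl scale c x y \<Longrightarrow> q_weyl scale (inverse c) y x"
  unfolding q_weyl_def by (metis inverse_inverse_eq minus_diff_eq scale_minus_left)

text \<open>Dividing the relation by \<open>inverse c\<close> and evaluating it at an eigenvector \<open>v\<close> gives
  \<open>y (x v) = c\<^sup>2 t (x v) - (c\<^sup>2 - 1) v\<close>; subtracting \<open>t\<inverse> v\<close> from \<open>x v\<close> absorbs the
  inhomogeneous term.\<close>

lemma q_weyl_raises:
  assumes W: "q_weyl scale c x y"
    and x: "Vector_Spaces.linear scale scale x" and y: "Vector_Spaces.linear scale scale y"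
    and c: "c \<noteq> 0" and t: "t \<noteq> 0" and v: "y v = scale t v"
  shows "y (x v - scale (inverse t) v) = scale (c\<^sup>2 * t) (x v - scale (inverse t) v)"
proof -
  interpret x: Vector_Spaces.linear scale scale x by (rule x)
  interpret y: Vector_Spaces.linear scale scale y by (rule y)
  have "scale (c * t) (x v) - scale (inverse c) (y (x v)) = scale (c - inverse c) v"
    using W[unfolded q_weyl_def, rule_format, of v] v by (simp add: x.scale)
  then have "scale c (scale (c * t) (x v) - scale (inverse c) (y (x v)))
      = scale c (scale (c - inverse c) v)" by simp
  then have "scale (c\<^sup>2 * t) (x v) - y (x v) = scale (c\<^sup>2 - 1) v"
    using c by (simp add: scale_right_diff_distrib power2_eq_square right_diff_distrib mult.assoc)
  then have "y (x v) = scale (c\<^sup>2 * t) (x v) - scale (c\<^sup>2 - 1) v"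
    by (simp add: algebra_simps)
  then show ?thesis
    using t by (simp add: y.diff y.scale v scale_right_diff_distrib scale_left_diff_distrib)
qed

text \<open>If the eigenvalue \<open>c\<^sup>2 t\<close> does not occur, there is no room for \<open>x v - t\<inverse> v\<close>. This is
  why decompositions that induce the same flag have the same component \<open>0\<close>.\<close>

lemma q_weyl_common_eigenvector:
  assumes W: "q_weyl scale c x y"
    and x: "Vector_Spaces.linear scale scale x" and y: "Vector_Spaces.linear scale scale y"
    and c: "c \<noteq> 0" and t: "t \<noteq> 0" and v: "y v = scale t v"
    and extreme: "\<And>w. y w = scale (c\<^sup>2 * t) w \<Longrightarrow> w = 0"
  shows "x v = scale (inverse t) v"
  using extreme[OF q_weyl_raises[OF W x y c t v]] by simp

text \<open>By \<open>q_weyl_raises\<close>, \<open>x (w n)\<close> is \<open>\<theta> n\<inverse> w n\<close> plus a vector \<open>r n\<close> in the eigenspace before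
  that of \<open>w n\<close>. Component \<open>m\<close> of the eigenvector equation is then
  \<open>(c\<^sup>d - \<theta> m\<inverse>) w m = r (Suc m)\<close>, where the scalar is nonzero for \<open>m < d\<close>.\<close>

lemma q_weyl_component_propagates:
  fixes d :: nat
  assumes W: "q_weyl scale c x y"
    and x: "Vector_Spaces.linear scale scale x" and y: "Vector_Spaces.linear scale scale y"
    and c: "c \<noteq> 0" and inf: "\<And>n::nat. n > 0 \<Longrightarrow> c ^ n \<noteq> 1"
    and w: "\<And>n. n \<le> d \<Longrightarrow> y (w n) = scale (c powi (int d - 2 * int n)) (w n)"
    and eig: "x (\<Sum>n\<le>d. w n) = scale (c powi int d) (\<Sum>n\<le>d. w n)"
    and m: "m < d" and zero: "w (Suc m) = 0"
  shows "w m = 0"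
proof -
  interpret x: Vector_Spaces.linear scale scale x by (rule x)
  interpret y: Vector_Spaces.linear scale scale y by (rule y)
  define \<theta> where "\<theta> n = c powi (int d - 2 * int n)" for n
  define r where "r n = x (w n) - scale (inverse (\<theta> n)) (w n)" for n
  \<comment> \<open>The eigenvalue list is extended by \<open>c powi (d + 2)\<close> at the front, since \<open>r 0\<close>
    belongs to that eigenvalue; index \<open>Suc n\<close> is the old index \<open>n\<close>.\<close>
  define \<phi> where "\<phi> n = c powi (int d + 2 - 2 * int n)" for n
  define a where "a n = scale (c powi int d - inverse (\<theta> n)) (w n)" for n
  define z where "z n = (case n of 0 \<Rightarrow> 0 | Suc n' \<Rightarrow> a n') - (if n \<le> d then r n else 0)" for n
  have \<theta>0: "\<theta> n \<noteq> 0" for n using c by (simp add: \<theta>_def)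
  have \<phi>: "c\<^sup>2 * \<theta> n = \<phi> n" "\<phi> (Suc n) = \<theta> n" for n
  proof -
    have "\<phi> n = c powi (2 + (int d - 2 * int n))" by (simp add: \<phi>_def algebra_simps)
    also have "\<dots> = c\<^sup>2 * \<theta> n"
      using c by (subst power_int_add) (simp_all add: \<theta>_def)
    finally show "c\<^sup>2 * \<theta> n = \<phi> n" by simp
    show "\<phi> (Suc n) = \<theta> n" by (simp add: \<phi>_def \<theta>_def)
  qed
  have r: "y (r n) = scale (\<phi> n) (r n)" if "n \<le> d" for n
    unfolding r_def \<phi>(1)[symmetric]
    by (rule q_weyl_raises[OF W x y c \<theta>0]) (simp add: w that \<theta>_def)
  have a: "y (a n) = scale (\<phi> (Suc n)) (a n)" if "n \<le> d" for n
    unfolding a_def \<phi>(2) using w[OF that] by (simp add: y.scale \<theta>_def mult.commute)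
  have z: "y (z n) = scale (\<phi> n) (z n)" if "n \<le> Suc d" for n
    using that r a
    by (auto simp: z_def y.diff y.zero scale_right_diff_distrib split: nat.split)
  have "(\<Sum>n\<le>Suc d. z n) = (\<Sum>n\<le>d. a n) - (\<Sum>n\<le>d. r n)"
  proof -
    have "(\<Sum>n\<le>Suc d. case n of 0 \<Rightarrow> 0 | Suc n' \<Rightarrow> a n') = (\<Sum>n\<le>d. a n)"
      by (subst sum.atMost_Suc_shift) simp
    moreover have "(\<Sum>n\<le>Suc d. if n \<le> d then r n else 0) = (\<Sum>n\<le>d. r n)"
      by simp
    ultimately show ?thesis unfolding z_def sum_subtractf by (simp only:)
  qed
  also have "\<dots> = scale (c powi int d) (\<Sum>n\<le>d. w n) - x (\<Sum>n\<le>d. w n)"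
    by (simp add: a_def r_def scale_left_diff_distrib sum_subtractf scale_sum_right x.sum)
  also have "\<dots> = 0" using eig by simp
  finally have "z (Suc m) = 0"
  proof (rule sum_eigenvectors_eq_0[OF y, of "{..Suc d}" \<phi>, rotated -2])
    show "inj_on \<phi> {..Suc d}"
      using power_int_eq_iff_of_infinite_order[OF c inf] by (auto simp: inj_on_def \<phi>_def)
  qed (use m z in auto)
  then have "a m = 0"
    using m zero by (simp add: z_def r_def x.zero)
  moreover have "c powi int d \<noteq> inverse (\<theta> m)"
    using m power_int_eq_iff_of_infinite_order[OF c inf, of "int d" "- (int d - 2 * int m)"]
    unfolding \<theta>_def power_int_minus[symmetric] by simp
  ultimately show ?thesis by (simp add: a_def)
qed

text \<open>The pair \<open>(x, y)\<close> carries vanishing of components downwards; the pair \<open>(y, z)\<close>, read with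
  \<open>c\<inverse>\<close> and the components in reverse order, carries it upwards.\<close>

lemma q_weyl_triple_components_nonzero:
  fixes d :: nat
  assumes W: "q_weyl scale c x y" "q_weyl scale c y z"
    and x: "Vector_Spaces.linear scale scale x" and y: "Vector_Spaces.linear scale scale y"
    and z: "Vector_Spaces.linear scale scale z"
    and c: "c \<noteq> 0" and inf: "\<And>n::nat. n > 0 \<Longrightarrow> c ^ n \<noteq> 1"
    and w: "\<And>n. n \<le> d \<Longrightarrow> y (w n) = scale (c powi (int d - 2 * int n)) (w n)"
    and v: "v = (\<Sum>n\<le>d. w n)" "v \<noteq> 0"
    and xv: "x v = scale (c powi int d) v" and zv: "z v = scale (c powi (- int d)) v"
    and n: "n \<le> d"
  shows "w n \<noteq> 0"
proof
  assume "w n = 0"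
  have down: "w m = 0" if "m < d" "w (Suc m) = 0" for m
    by (rule q_weyl_component_propagates[OF W(1) x y c inf w _ that]) (use xv v in auto)
  have up: "w (Suc m) = 0" if m: "m < d" "w m = 0" for m
  proof -
    define w' where "w' n = w (d - n)" for n
    have "w' (d - Suc m) = 0"
    proof (rule q_weyl_component_propagates[OF q_weyl_inverse[OF W(2)] z y, of d])
      show "inverse c \<noteq> 0" using c by simp
      show "inverse c ^ n \<noteq> 1" if "n > 0" for n :: nat
        using inf[OF that] by (simp add: power_inverse)
      show "y (w' n) = scale (inverse c powi (int d - 2 * int n)) (w' n)" if "n \<le> d" for n
      proof -
        have "int d - 2 * int (d - n) = - (int d - 2 * int n)" using that by simp
        then show ?thesis
          using w[of "d - n"] by (simp only: w'_def power_int_minus power_int_inverse diff_le_self)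
      qed
      have "(\<Sum>n\<le>d. w' n) = v"
        unfolding v w'_def
      by (rule sum.reindex_bij_witness[where i = "\<lambda>n. d - n" and j = "\<lambda>n. d - n"]) auto
      then show "z (\<Sum>n\<le>d. w' n) = scale (inverse c powi int d) (\<Sum>n\<le>d. w' n)"
        using zv by (simp add: power_int_minus power_int_inverse power_inverse)
      show "d - Suc m < d" using m by simp
      show "w' (Suc (d - Suc m)) = 0" using m by (simp add: w'_def Suc_diff_Suc)
    qed
    then show ?thesis using m by (simp add: w'_def)
  qed
  have "w k = 0" if "k \<le> d" for k
  proof (cases "k \<le> n")
    case True
    then show ?thesis
      using \<open>w n = 0\<close> n by (induction rule: inc_induct) (auto intro: down)
  next
    case False
    then have "n \<le> k" by simp
    then show ?thesis
      using \<open>w n = 0\<close> that by (induction rule: dec_induct) (auto intro: up)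
  qed
  then show False using v by simp
qed

end

section \<open>Modules for the \<open>q\<close>-tetrahedron algebra\<close>


text \<open>Needed for the free algebra, which is not commutative.\<close>

lemma ring_of_type_algebra_ring: "ring (ring_of_type_algebra :: 'a::ring_1 ring)"
proof -
  have "\<exists>y. x + y = 0" for x :: 'a
    using add.right_inverse by blast
  then show ?thesis
    unfolding ring_of_type_algebra_def
    by unfold_locales (auto simp: algebra_simps Units_def)
qed

lemma qtet_ideal_ideal: "ideal (qtet_ideal q) ring_of_type_algebra"
  unfolding qtet_ideal_def
  by (rule ring.genideal_ideal[OF ring_of_type_algebra_ring]) (simp add: ring_of_type_algebra_def)

lemma qtet_class_hom: "qtet_class q \<in> ring_hom ring_of_type_algebra (qtet q)"
  unfolding qtet_class_def[abs_def] qtet_def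
  by (rule ideal.rcos_ring_hom[OF qtet_ideal_ideal])

lemma qtet_class_relator:
  assumes "p \<in> qtet_relators q"
  shows "qtet_class q p = qtet_class q 0"
proof -
  have "p \<in> qtet_ideal q" "0 \<in> qtet_ideal q"
    using ring.genideal_self[OF ring_of_type_algebra_ring, of "qtet_relators q"] assms
      additive_subgroup.zero_closed[OF ideal.axioms(1)[OF qtet_ideal_ideal, of q]]
    by (auto simp: qtet_ideal_def ring_of_type_algebra_def)
  moreover have "qtet_ideal q +>\<^bsub>ring_of_type_algebra\<^esub> h = qtet_ideal q" if "h \<in> qtet_ideal q" for h
    by (rule abelian_subgroup.a_rcos_const[OF abelian_subgroupI3[OF ideal.axioms(1) ring.is_abelian_group,
      OF qtet_ideal_ideal ring_of_type_algebra_ring] that])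
  ultimately show ?thesis by (simp add: qtet_class_def)
qed

lemma Z4_cases: "(x::4) = 0 \<or> x = 1 \<or> x = 2 \<or> x = 3"
proof (cases x)
  case (of_int z)
  then have "z = 0 \<or> z = 1 \<or> z = 2 \<or> z = 3" by auto
  then show ?thesis using of_int by auto
qed

text \<open>Walking cyclically through three distinct points of \<open>\<int>\<^sub>4\<close> in one of the two directions takes
  two steps of length 1 and one of length 2, so consecutive steps satisfy the index condition of the
  \<open>q\<close>-Weyl relations.\<close>

lemma Z4_triple_orientation:
  fixes j k l :: 4
  assumes "distinct [j, k, l]"
  shows "(k - j, l - k, j - l) \<in> {(1, 1, 2), (1, 2, 1), (2, 1, 1)} \<or>
         (l - j, k - l, j - k) \<in> {(1, 1, 2), (1, 2, 1), (2, 1, 1)}"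
  using assms Z4_cases[of j] Z4_cases[of k] Z4_cases[of l] by (elim disjE) simp_all

context qtet_module
begin

text \<open>The action pulled back to the free algebra, where the relators can be evaluated without
  calculating with cosets.\<close>

definition rep :: "(std_gen, 'f) free_algebra \<Rightarrow> 'v \<Rightarrow> 'v" where
  "rep p = act (qtet_class q p)"

definition gen_op :: "4 \<Rightarrow> 4 \<Rightarrow> 'v \<Rightarrow> 'v" where
  "gen_op i j = rep (fx i j)"

lemma qtet_class_carrier: "qtet_class q p \<in> carrier (qtet q)"
  using ring_hom_closed[OF qtet_class_hom] by (simp add: ring_of_type_algebra_def)

lemma rep_linear: "Vector_Spaces.linear scale scale (rep p)"
  unfolding rep_def by (rule act_linear[OF qtet_class_carrier])

lemma rep_add: "rep (p + r) v = rep p v + rep r v"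
  using ring_hom_add[OF qtet_class_hom, of p r] act_add[OF qtet_class_carrier qtet_class_carrier, of p r v]
  by (simp add: rep_def ring_of_type_algebra_def)

lemma rep_mult: "rep (p * r) v = rep p (rep r v)"
  using ring_hom_mult[OF qtet_class_hom, of p r] act_mult[OF qtet_class_carrier qtet_class_carrier, of p r v]
  by (simp add: rep_def ring_of_type_algebra_def)

lemma rep_one: "rep 1 v = v"
  using ring_hom_one[OF qtet_class_hom, of q] act_one by (simp add: rep_def ring_of_type_algebra_def)

lemma rep_diff: "rep (p - r) v = rep p v - rep r v"
  using rep_add[of "p - r" r v] by (simp add: algebra_simps)

lemma rep_scalar: "rep (free_scalar c) v = scale c v"
  using act_scalar by (simp add: rep_def qtet_scalar_def)

lemma rep_relator:
  assumes "p \<in> qtet_relators q"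
  shows "rep p v = 0"
  using qtet_class_relator[OF assms] rep_diff[of 0 0 v] by (simp add: rep_def)

lemma gen_op_eq: "gen_op i j = act (qtet_gen q i j)"
  by (simp add: gen_op_def rep_def qtet_gen_def)

lemma gen_op_linear: "Vector_Spaces.linear scale scale (gen_op i j)"
  unfolding gen_op_def by (rule rep_linear)

lemma gen_op_inverse:
  assumes "j - i = 2"
  shows "gen_op i j (gen_op j i v) = v"
proof -
  have "rep (fx i j * fx j i - 1) v = 0"
    by (rule rep_relator) (use assms in \<open>auto simp: qtet_relators_def\<close>)
  then show ?thesis by (simp add: rep_diff rep_mult rep_one gen_op_def)
qed

lemma gen_op_q_weyl:
  assumes "(j - i, k - j) \<in> {(1, 1), (1, 2), (2, 1)}" and q: "q - inverse q \<noteq> 0"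
  shows "q_weyl scale q (gen_op i j) (gen_op j k)"
  unfolding q_weyl_def
proof
  fix v
  let ?w = "scale q (gen_op i j (gen_op j k v)) - scale (inverse q) (gen_op j k (gen_op i j v))"
  have "rep (free_scalar (1 / (q - inverse q)) *
      (free_scalar q * fx i j * fx j k - free_scalar (inverse q) * fx j k * fx i j) - 1) v = 0"
    by (rule rep_relator) (use assms in \<open>unfold qtet_relators_def, blast\<close>)
  then have "scale (1 / (q - inverse q)) ?w = v"
    by (simp add: rep_diff rep_mult rep_one rep_scalar gen_op_def)
  then have "scale (q - inverse q) (scale (1 / (q - inverse q)) ?w) = scale (q - inverse q) v"
    by simp
  then show "?w = scale (q - inverse q) v" using q by simp
qed

section \<open>Flags and decompositions\<close>

lemma decomposition_branch:
  assumes "k \<noteq> (l :: 4)"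
  obtains "l - k \<in> {1, 2}" | "l - k \<notin> {1, 2}" "k - l \<in> {1, 2}"
  using assms Z4_cases[of k] Z4_cases[of l] by (elim disjE) simp_all

text \<open>Both branches of the definition of a decomposition list the eigenspaces of one standard
  generator, either in the standard or in the reversed order of its eigenvalues.\<close>

lemma decomposition_eigenspaces:
  assumes q: "q \<noteq> 0" and inf: "\<And>n::nat. n > 0 \<Longrightarrow> q ^ n \<noteq> 1"
    and diam: "has_diameter_and_type d 1" and kl: "k \<noteq> l"
  obtains T \<theta> where "Vector_Spaces.linear scale scale T" "diagonalizable T"
    "eigenvalues T = \<theta> ` {..d}" "inj_on \<theta> {..d}"
    "\<And>n. n \<le> d \<Longrightarrow> decomposition d k l n = eigenspace T (\<theta> n)"
proof (cases rule: decomposition_branch[OF kl])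
  case 1
  show ?thesis
  proof (rule that[of "gen_op k l" "\<lambda>n. q powi (int d - 2 * int n)"])
    show "inj_on (\<lambda>n. q powi (int d - 2 * int n)) {..d}"
      by (auto simp: inj_on_def power_int_eq_iff_of_infinite_order[OF q inf])
    show "eigenvalues (gen_op k l) = (\<lambda>n. q powi (int d - 2 * int n)) ` {..d}"
      using diam 1 by (auto simp: has_diameter_and_type_def gen_op_eq)
  qed (use diam 1 in \<open>auto simp: gen_op_linear[unfolded gen_op_eq] has_diameter_and_type_def gen_op_eq decomposition_def\<close>)
next
  case 2
  show ?thesis
  proof (rule that[of "gen_op l k" "\<lambda>n. q powi (int d - 2 * int (d - n))"])
    show "inj_on (\<lambda>n. q powi (int d - 2 * int (d - n))) {..d}"
      by (auto simp: inj_on_def power_int_eq_iff_of_infinite_order[OF q inf])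
    have "(\<lambda>n. q powi (int d - 2 * int (d - n))) ` {..d} =
        (\<lambda>n. q powi (int d - 2 * int n)) ` (\<lambda>n. d - n) ` {..d}"
      by (simp add: image_image)
    also have "(\<lambda>n. d - n) ` {..d} = {..d}"
    proof (intro equalityI subsetI)
      fix n assume "n \<in> {..d}"
      then show "n \<in> (\<lambda>n. d - n) ` {..d}" by (intro image_eqI[of _ _ "d - n"]) auto
    qed auto
    finally show "eigenvalues (gen_op l k) = (\<lambda>n. q powi (int d - 2 * int (d - n))) ` {..d}"
      using diam 2 by (auto simp: has_diameter_and_type_def gen_op_eq)
  qed (use diam 2 in \<open>auto simp: gen_op_linear[unfolded gen_op_eq] has_diameter_and_type_def gen_op_eq decomposition_def\<close>)
qed

text \<open>Only \<open>l - k = 2\<close> needs an argument: there \<open>[k,l]\<close> and \<open>[l,k]\<close> are defined from two different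
  generators, which are inverse to each other.\<close>

lemma decomposition_reverse:
  assumes q: "q \<noteq> 0" and kl: "k \<noteq> l" and n: "n \<le> d"
  shows "decomposition d l k (d - n) = decomposition d k l n"
proof -
  have rev: "int d - 2 * int (d - n) = - (int d - 2 * int n)" using n by simp
  have half: "eigenspace (gen_op l k) (inverse t) = eigenspace (gen_op k l) t"
    if kl2: "l - k = 2" "k - l = 2" and t: "t \<noteq> 0" for t
  proof -
    have "gen_op j i v = scale (inverse t) v"
      if "gen_op i j v = scale t v" "i - j = 2" "t \<noteq> 0" for i j v t
    proof -
      interpret g: Vector_Spaces.linear scale scale "gen_op j i" by (rule gen_op_linear)
      have "v = scale t (gen_op j i v)"
        using gen_op_inverse[of i j v] that by (simp add: g.scale)
      then have "scale (inverse t) v = scale (inverse t) (scale t (gen_op j i v))" by simp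
      then show ?thesis using that by simp
    qed
    from this[of k l _ t] this[of l k _ "inverse t"] show ?thesis
      using kl2 t by (auto simp: eigenspace_def)
  qed
  consider "l - k = 1" "k - l = 3" | "l - k = 2" "k - l = 2" | "l - k = 3" "k - l = 1"
    using kl Z4_cases[of k] Z4_cases[of l] by (elim disjE) simp_all
  then show ?thesis
  proof cases
    case 2
    then show ?thesis
      using half[OF 2, of "q powi (int d - 2 * int n)"] q
      unfolding decomposition_def rev power_int_minus gen_op_eq by simp
  qed (use n in \<open>auto simp: decomposition_def\<close>)
qed

text \<open>The flag \<open>[j]\<close> is defined from the generator \<open>x\<^sub>j\<^sub>,\<^sub>j\<^sub>+\<^sub>1\<close>. A generator \<open>x\<^sub>l\<^sub>j\<close> is in a \<open>q\<close>-Weyl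
  relation with it, and \<open>q\<^sup>d\<^sup>+\<^sup>2\<close> is no eigenvalue, so \<open>x\<^sub>l\<^sub>j\<close> shares the eigenvector. For the outgoing
  generator \<open>x\<^sub>j\<^sub>,\<^sub>j\<^sub>+\<^sub>2\<close> one passes to the inverse \<open>x\<^sub>j\<^sub>+\<^sub>2\<^sub>,\<^sub>j\<close>.\<close>

lemma flag_vector_eigenvector:
  assumes q: "q \<noteq> 0" and inf: "\<And>n::nat. n > 0 \<Longrightarrow> q ^ n \<noteq> 1"
    and diam: "has_diameter_and_type d 1" and v: "v \<in> flag d j 0"
  shows "k - j \<in> {1, 2} \<Longrightarrow> gen_op j k v = scale (q powi int d) v"
    and "j - l \<in> {1, 2} \<Longrightarrow> gen_op l j v = scale (q powi (- int d)) v"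
proof -
  note sub = diff_inverse_neq_0_of_infinite_order[OF q inf]
  have outgoing: "gen_op j (j + 1) v = scale (q powi int d) v"
    using v by (auto simp: flag_def decomposition_def eigenspace_def gen_op_eq)
  have extreme: "w = 0" if "gen_op j (j + 1) w = scale (q\<^sup>2 * q powi int d) w" for w
  proof (rule ccontr)
    assume "w \<noteq> 0"
    have "q\<^sup>2 * q powi int d = q powi (2 + int d)"
      using q by (subst power_int_add) simp_all
    then have "q powi (2 + int d) \<in> eigenvalues (gen_op j (j + 1))"
      using that \<open>w \<noteq> 0\<close> by (auto simp: eigenvalues_def eigenspace_def)
    then obtain n where "n \<le> d" "q powi (2 + int d) = q powi (int d - 2 * int n)"
      using diam by (auto simp: has_diameter_and_type_def gen_op_eq)
    then show False
      using power_int_eq_iff_of_infinite_order[OF q inf] by auto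
  qed
  show incoming: "gen_op l j v = scale (q powi (- int d)) v" if l: "j - l \<in> {1, 2}" for l
    unfolding power_int_minus
  proof (rule q_weyl_common_eigenvector[OF _ gen_op_linear gen_op_linear q _ outgoing extreme])
    show "q_weyl scale q (gen_op l j) (gen_op j (j + 1))"
      by (rule gen_op_q_weyl) (use l sub in auto)
  qed (use q in simp_all)
  show "gen_op j k v = scale (q powi int d) v" if k: "k - j \<in> {1, 2}" for k
  proof (cases "k - j = 1")
    case True
    then show ?thesis using outgoing by (simp add: algebra_simps)
  next
    case False
    interpret g: Vector_Spaces.linear scale scale "gen_op j k" by (rule gen_op_linear)
    have "k - j = 2" "j - k = 2"
      using False k Z4_cases[of k] Z4_cases[of j] by (auto simp: algebra_simps)
    then have "v = scale (q powi (- int d)) (gen_op j k v)"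
      using gen_op_inverse[of k j v] incoming[of k] by (simp add: g.scale)
    then have "scale (q powi int d) v = scale (q powi int d) (scale (q powi (- int d)) (gen_op j k v))"
      by simp
    then show ?thesis using q by (simp add: power_int_minus)
  qed
qed

text \<open>The heart of the theorem: in one of the two orientations of \<open>(j, k, l)\<close>, the generators
  \<open>x\<^sub>j\<^sub>k\<close>, \<open>x\<^sub>k\<^sub>l\<close>, \<open>x\<^sub>l\<^sub>j\<close> form a triple as in \<open>q_weyl_triple_components_nonzero\<close>; the other
  orientation is reduced to it by reversing the decomposition.\<close>

lemma flag_vector_components_nonzero:
  assumes q: "q \<noteq> 0" and inf: "\<And>n::nat. n > 0 \<Longrightarrow> q ^ n \<noteq> 1"
    and diam: "has_diameter_and_type d 1"
    and v: "v \<in> flag d j 0" "v \<noteq> 0" and jkl: "distinct [j, k, l]"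
    and w: "\<And>n. n \<le> d \<Longrightarrow> w n \<in> decomposition d k l n" "v = (\<Sum>n\<le>d. w n)"
    and n: "n \<le> d"
  shows "w n \<noteq> 0"
proof -
  note sub = diff_inverse_neq_0_of_infinite_order[OF q inf]
  have oriented: "w n \<noteq> 0"
    if o: "(k - j, l - k, j - l) \<in> {(1, 1, 2), (1, 2, 1), (2, 1, 1)}"
      and w: "\<And>n. n \<le> d \<Longrightarrow> w n \<in> decomposition d k l n" "v = (\<Sum>n\<le>d. w n)"
      and n: "n \<le> d" for k l w n
  proof (rule q_weyl_triple_components_nonzero[OF _ _ gen_op_linear gen_op_linear gen_op_linear q inf
        _ w(2) v(2) _ _ n])
    show "q_weyl scale q (gen_op j k) (gen_op k l)" "q_weyl scale q (gen_op k l) (gen_op l j)"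
      by (rule gen_op_q_weyl; use o sub in auto)+
    show "gen_op j k v = scale (q powi int d) v" "gen_op l j v = scale (q powi (- int d)) v"
      by (rule flag_vector_eigenvector[OF q inf diam v(1)]; use o in auto)+
    show "gen_op k l (w m) = scale (q powi (int d - 2 * int m)) (w m)" if "m \<le> d" for m
      using w(1)[OF that] o by (auto simp: decomposition_def eigenspace_def gen_op_eq)
  qed
  show ?thesis
  proof (cases "(k - j, l - k, j - l) \<in> {(1, 1, 2), (1, 2, 1), (2, 1, 1)}")
    case True
    then show ?thesis using oriented w n by blast
  next
    case False
    then have o: "(l - j, k - l, j - k) \<in> {(1, 1, 2), (1, 2, 1), (2, 1, 1)}"
      using Z4_triple_orientation[OF jkl] by blast
    have "w (d - (d - n)) \<noteq> 0"
    proof (rule oriented[OF o, where w = "\<lambda>m. w (d - m)"])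
      show "w (d - m) \<in> decomposition d l k m" if "m \<le> d" for m
        using decomposition_reverse[OF q, of l k m d] w(1)[of "d - m"] jkl that by auto
      show "v = (\<Sum>m\<le>d. w (d - m))"
        unfolding w(2)
        by (rule sum.reindex_bij_witness[where i = "\<lambda>n. d - n" and j = "\<lambda>n. d - n"]) auto
    qed simp
    then show ?thesis using n by simp
  qed
qed

text \<open>A nonzero vector spans its one-dimensional eigenspace, and eigenvectors for distinct
  eigenvalues are independent.\<close>

lemma basis_seq_of_nonzero_eigenvectors:
  assumes lin: "Vector_Spaces.linear scale scale T"
    and expansion: "\<And>v. \<exists>w. (\<forall>n\<in>{..d}. T (w n) = scale (\<theta> n) (w n)) \<and> v = (\<Sum>n\<le>d. w n)"
    and inj: "inj_on \<theta> {..d}"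
    and dim: "\<And>n. n \<le> d \<Longrightarrow> dim (eigenspace T (\<theta> n)) = 1"
    and u: "\<And>n. n \<le> d \<Longrightarrow> u n \<in> eigenspace T (\<theta> n)" "\<And>n. n \<le> d \<Longrightarrow> u n \<noteq> 0"
  shows "basis_seq d u"
proof -
  interpret T: Vector_Spaces.linear scale scale T by (rule lin)
  have u': "T (u n) = scale (\<theta> n) (u n)" if "n \<le> d" for n
    using u(1)[OF that] by (simp add: eigenspace_def)
  have inj_u: "inj_on u {..d}"
  proof (rule inj_onI)
    fix m n assume mn: "m \<in> {..d}" "n \<in> {..d}" "u m = u n"
    then have "scale (\<theta> m) (u m) = scale (\<theta> n) (u m)"
      using u'[of m] u'[of n] by (metis atMost_iff)
    moreover have "u m \<noteq> 0" using u(2) mn by simp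
    ultimately have "\<theta> m = \<theta> n" using scale_right_imp_eq by blast
    then show "m = n" using inj mn by (auto simp: inj_on_def)
  qed
  have "independent (u ` {..d})"
  proof (rule independent_if_scalars_zero)
    fix f x assume s: "(\<Sum>x\<in>u ` {..d}. scale (f x) x) = 0" and "x \<in> u ` {..d}"
    then obtain m where m: "m \<le> d" "x = u m" by auto
    have "(\<Sum>n\<le>d. scale (f (u n)) (u n)) = 0"
      using s sum.reindex[OF inj_u, of "\<lambda>x. scale (f x) x"] by simp
    then have "scale (f (u m)) (u m) = 0"
      by (rule sum_eigenvectors_eq_0[OF lin _ inj, rotated -2])
        (use m u' in \<open>auto simp: T.scale mult.commute\<close>)
    then show "f x = 0" using m u(2) by simp
  qed simp
  moreover have "v \<in> span (u ` {..d})" for v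
  proof -
    obtain w where w: "\<forall>n\<in>{..d}. T (w n) = scale (\<theta> n) (w n)" "v = (\<Sum>n\<le>d. w n)"
      using expansion by blast
    have "w n \<in> span (u ` {..d})" if n: "n \<in> {..d}" for n
    proof -
      have "w n \<in> span {u n}"
        using subset_span_of_dim_1[of "eigenspace T (\<theta> n)" "u n"] dim[of n] u[of n] w n
        by (auto simp: eigenspace_def)
      then show ?thesis using span_mono[of "{u n}" "u ` {..d}"] n by auto
    qed
    then show ?thesis unfolding w(2) by (rule span_sum)
  qed
  ultimately show ?thesis using inj_u by (auto simp: basis_seq_def)
qed

lemma unique_expansion_of_flag_vector:
  assumes q: "q \<noteq> 0" and inf: "\<And>n::nat. n > 0 \<Longrightarrow> q ^ n \<noteq> 1"
    and eval: "evaluation_module d"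
    and v: "v \<in> flag d j 0" "v \<noteq> 0" and jkl: "distinct [j, k, l]"
  shows "\<exists>!u. u \<in> extensional {..d} \<and> basis_seq d u \<and>
           (\<forall>n\<le>d. u n \<in> decomposition d k l n) \<and> v = (\<Sum>n\<le>d. u n)"
proof -
  have diam: "has_diameter_and_type d 1" and kl: "k \<noteq> l"
    using eval jkl by (simp_all add: evaluation_module_def)
  obtain T \<theta> where lin: "Vector_Spaces.linear scale scale T" and diag: "diagonalizable T"
    and ev: "eigenvalues T = \<theta> ` {..d}" and inj: "inj_on \<theta> {..d}"
    and dec: "\<And>n. n \<le> d \<Longrightarrow> decomposition d k l n = eigenspace T (\<theta> n)"
    using decomposition_eigenspaces[OF q inf diam kl] by blast
  interpret T: Vector_Spaces.linear scale scale T by (rule lin)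
  have expansion: "\<exists>w. (\<forall>n\<in>{..d}. T (w n) = scale (\<theta> n) (w n)) \<and> v = (\<Sum>n\<le>d. w n)" for v
  proof -
    obtain B where B: "independent B" "span B = UNIV" "\<And>b. b \<in> B \<Longrightarrow> \<exists>c. b \<in> eigenspace T c"
      using diag by (auto simp: diagonalizable_def)
    show ?thesis
    proof (rule ex_eigenvector_expansion[OF lin _ B(1,2)])
      fix b assume b: "b \<in> B"
      then obtain c where c: "b \<in> eigenspace T c" using B by blast
      have "b \<noteq> 0" using b B(1) dependent_zero by blast
      then have "c \<in> \<theta> ` {..d}" using c ev[symmetric] by (auto simp: eigenvalues_def)
      then show "\<exists>n\<in>{..d}. T b = scale (\<theta> n) b" using c by (auto simp: eigenspace_def)
    qed simp
  qed
  obtain w where w: "\<forall>n\<in>{..d}. T (w n) = scale (\<theta> n) (w n)" "v = (\<Sum>n\<le>d. w n)"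
    using expansion by blast
  define u where "u = restrict w {..d}"
  have u: "u n \<in> decomposition d k l n" if "n \<le> d" for n
    using w(1) that by (simp add: u_def dec eigenspace_def)
  have sum: "v = (\<Sum>n\<le>d. u n)" using w(2) by (simp add: u_def)
  have nz: "u n \<noteq> 0" if "n \<le> d" for n
    by (rule flag_vector_components_nonzero[OF q inf diam v jkl u sum that])
  show ?thesis
  proof (rule ex1I[of _ u], intro conjI)
    show "u \<in> extensional {..d}" by (simp add: u_def)
    show "basis_seq d u"
    proof (rule basis_seq_of_nonzero_eigenvectors[OF lin expansion inj])
      show "dim (eigenspace T (\<theta> n)) = 1" if "n \<le> d" for n
        using eval kl that unfolding dec[OF that, symmetric] by (simp add: evaluation_module_def)
    qed (use u dec nz in auto)
    show "\<forall>n\<le>d. u n \<in> decomposition d k l n" using u by blast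
    show "v = (\<Sum>n\<le>d. u n)" by (rule sum)
  next
    fix u' assume u': "u' \<in> extensional {..d} \<and> basis_seq d u' \<and>
      (\<forall>n\<le>d. u' n \<in> decomposition d k l n) \<and> v = (\<Sum>n\<le>d. u' n)"
    have "u' n - u n = 0" if n: "n \<in> {..d}" for n
    proof (rule sum_eigenvectors_eq_0[OF lin _ inj _ _ n])
      show "T (u' m - u m) = scale (\<theta> m) (u' m - u m)" if "m \<in> {..d}" for m
        using u' u[of m] that dec[of m] by (auto simp: T.diff scale_right_diff_distrib eigenspace_def)
      show "(\<Sum>m\<le>d. u' m - u m) = 0"
        using u' sum by (simp add: sum_subtractf)
    qed simp
    then show "u' = u"
      using u' by (intro extensionalityI[of _ "{..d}"]) (auto simp: u_def)
  qed
qed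

end

theorem lemma12p4:
  fixes q :: "'f::alg_closed_field"
    and scale :: "'f \<Rightarrow> 'v::ab_group_add \<Rightarrow> 'v"
    and act :: "(std_gen, 'f) free_algebra set \<Rightarrow> 'v \<Rightarrow> 'v"
    and d :: nat
    and \<eta> :: "4 \<Rightarrow> 'v"
    and i j k l :: 4
  assumes q_nonzero: "q \<noteq> 0"
    and q_not_root_of_unity: "\<And>n::nat. n > 0 \<Longrightarrow> q ^ n \<noteq> 1"
    and V: "qtet_module scale q act"
    and eval: "qtet_module.evaluation_module scale q act d"
    and eta_nonzero: "\<And>m. \<eta> m \<noteq> 0"
    and eta_flag: "\<And>m. \<eta> m \<in> qtet_module.flag scale q act d m 0"
    and ijkl: "distinct [i, j, k, l]"
  shows "\<exists>!u. u \<in> extensional {..d} \<and> qtet_module.basis_seq scale d u \<and>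
           (\<forall>n\<le>d. u n \<in> qtet_module.decomposition scale q act d k l n) \<and>
           \<eta> j = (\<Sum>n\<le>d. u n)"
  using qtet_module.unique_expansion_of_flag_vector[OF V q_nonzero q_not_root_of_unity eval
      eta_flag eta_nonzero, of j k l] ijkl
  by simp

end
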